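(* For all formulas $\phi,\psi$, both $\phi\wedge\psi\to\phi$ and $\phi\to\phi\vee\psi$ are theorems of the propositional proof system IRL defined in the context.
   Context: Language: formulas are built from a countable set $K$ of primitive propositions using the connectives $\top,\bot$ (nullary), $\neg$ (unary), $\wedge,\vee,\leftrightarrow,\to$ (binary, all syntactically independent symbols). $\neg$ binds strongest, and $\wedge,\vee$ bind more strongly than $\to,\leftrightarrow$. Schematic letters $\phi,\psi,\chi$ range over all formulas. Axiom schemas of IRL: $\phi\leftrightarrow\phi$; $\phi\wedge\psi\leftrightarrow\psi\wedge\phi$; $\phi\vee\psi\leftrightarrow\psi\vee\phi$; $(\phi\wedge\psi)\wedge\chi\leftrightarrow\phi\wedge(\psi\wedge\chi)$; $(\phi\vee\psi)\vee\chi\leftrightarrow\phi\vee(\psi\vee\chi)$; $\phi\wedge(\psi\vee\chi)\leftrightarrow(\phi\wedge\psi)\vee(\phi\wedge\chi)$; $\phi\vee(\psi\wedge\chi)\leftrightarrow(\phi\vee\psi)\wedge(\phi\vee\chi)$; $\phi\wedge\top\leftrightarrow\phi$; $\phi\vee\bot\leftrightarrow\phi$; $\phi\wedge\neg\phi\leftrightarrow\bot$; $\phi\vee\neg\phi\leftrightarrow\top$; $(\phi\to\psi)\leftrightarrow(\phi\wedge\psi\leftrightarrow\phi)$. Primitive rules of IRL: (R1) from $\phi,\psi$ infer $\phi\wedge\psi$; (R2) from $\phi\wedge\psi$ infer $\phi$; (R3) from $\phi\leftrightarrow\psi$ and $\chi$ infer $\chi[\phi\mapsto\psi]$, where $\chi[\phi\mapsto\psi]$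 is any formula obtained from $\chi$ by replacing one or more arbitrarily selected occurrences of the subformula $\phi$ by $\psi$; (R4, conditional proof) if $\{\phi\}\vdash\psi$ then $\vdash\phi\to\psi$. Derivations: for a finite set $X$ of formulas, $X\vdash y$ means there is a finite sequence of formulas ending in $y$, each member of which is a theorem or results from members of $X$ and earlier members of the sequence by R1, R2 or R3. A theorem is a formula $y$ with $\emptyset\vdash y$ (written $\vdash y$); axioms are theorems, and formulas $\phi\to\psi$ obtained by R4 are theorems. R4 applies only to derivations with the single premise $\phi$ and no other undischarged premises. *)

theory Defs
  imports Main "HOL-Library.Countable"
begin

datatype binop = AndOp | OrOp | IffOp | ImpOp

text \<open>The four binary connectives are distinct primitive symbols; they share one constructor only
  so that replacement of subformulas can treat them uniformly.\<close>

datatype 'k form =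
    Prim 'k
  | Top ("\<^bold>\<top>")
  | Bot ("\<^bold>\<bottom>")
  | Neg "'k form" ("\<^bold>\<not> _" [90] 90)
  | Bin binop "'k form" "'k form"

abbreviation And :: "'k form \<Rightarrow> 'k form \<Rightarrow> 'k form" (infixr "\<^bold>\<and>" 85)
  where "\<phi> \<^bold>\<and> \<psi> \<equiv> Bin AndOp \<phi> \<psi>"

abbreviation Or :: "'k form \<Rightarrow> 'k form \<Rightarrow> 'k form" (infixr "\<^bold>\<or>" 85)
  where "\<phi> \<^bold>\<or> \<psi> \<equiv> Bin OrOp \<phi> \<psi>"

abbreviation Iff :: "'k form \<Rightarrow> 'k form \<Rightarrow> 'k form" (infixr "\<^bold>\<longleftrightarrow>" 80)
  where "\<phi> \<^bold>\<longleftrightarrow> \<psi> \<equiv> Bin IffOp \<phi> \<psi>"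

abbreviation Imp :: "'k form \<Rightarrow> 'k form \<Rightarrow> 'k form" (infixr "\<^bold>\<longrightarrow>" 80)
  where "\<phi> \<^bold>\<longrightarrow> \<psi> \<equiv> Bin ImpOp \<phi> \<psi>"

inductive irl_axiom :: "'k form \<Rightarrow> bool" where
  iff_refl: "irl_axiom (\<phi> \<^bold>\<longleftrightarrow> \<phi>)"
| and_comm: "irl_axiom ((\<phi> \<^bold>\<and> \<psi>) \<^bold>\<longleftrightarrow> (\<psi> \<^bold>\<and> \<phi>))"
| or_comm: "irl_axiom ((\<phi> \<^bold>\<or> \<psi>) \<^bold>\<longleftrightarrow> (\<psi> \<^bold>\<or> \<phi>))"
| and_assoc: "irl_axiom (((\<phi> \<^bold>\<and> \<psi>) \<^bold>\<and> \<chi>) \<^bold>\<longleftrightarrow> (\<phi> \<^bold>\<and> (\<psi> \<^bold>\<and> \<chi>)))"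
| or_assoc: "irl_axiom (((\<phi> \<^bold>\<or> \<psi>) \<^bold>\<or> \<chi>) \<^bold>\<longleftrightarrow> (\<phi> \<^bold>\<or> (\<psi> \<^bold>\<or> \<chi>)))"
| and_or_distrib: "irl_axiom ((\<phi> \<^bold>\<and> (\<psi> \<^bold>\<or> \<chi>)) \<^bold>\<longleftrightarrow> ((\<phi> \<^bold>\<and> \<psi>) \<^bold>\<or> (\<phi> \<^bold>\<and> \<chi>)))"
| or_and_distrib: "irl_axiom ((\<phi> \<^bold>\<or> (\<psi> \<^bold>\<and> \<chi>)) \<^bold>\<longleftrightarrow> ((\<phi> \<^bold>\<or> \<psi>) \<^bold>\<and> (\<phi> \<^bold>\<or> \<chi>)))"
| and_top: "irl_axiom ((\<phi> \<^bold>\<and> \<^bold>\<top>) \<^bold>\<longleftrightarrow> \<phi>)"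
| or_bot: "irl_axiom ((\<phi> \<^bold>\<or> \<^bold>\<bottom>) \<^bold>\<longleftrightarrow> \<phi>)"
| and_neg: "irl_axiom ((\<phi> \<^bold>\<and> (\<^bold>\<not> \<phi>)) \<^bold>\<longleftrightarrow> \<^bold>\<bottom>)"
| or_neg: "irl_axiom ((\<phi> \<^bold>\<or> (\<^bold>\<not> \<phi>)) \<^bold>\<longleftrightarrow> \<^bold>\<top>)"
| imp_iff: "irl_axiom ((\<phi> \<^bold>\<longrightarrow> \<psi>) \<^bold>\<longleftrightarrow> ((\<phi> \<^bold>\<and> \<psi>) \<^bold>\<longleftrightarrow> \<phi>))"

text \<open>\<open>replaces \<phi> \<psi> \<chi> \<chi>'\<close>: the formula \<open>\<chi>'\<close> is obtained from \<open>\<chi>\<close> by simultaneously replacing at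
  least one occurrence of \<open>\<phi>\<close> by \<open>\<psi>\<close>. Distinct occurrences of \<open>\<phi>\<close> never overlap, and copies of \<open>\<phi>\<close>
  inside an inserted \<open>\<psi>\<close> are not replaced again.\<close>

inductive replaces :: "'k form \<Rightarrow> 'k form \<Rightarrow> 'k form \<Rightarrow> 'k form \<Rightarrow> bool" for \<phi> \<psi> where
  here: "replaces \<phi> \<psi> \<phi> \<psi>"
| neg: "replaces \<phi> \<psi> \<chi> \<chi>' \<Longrightarrow> replaces \<phi> \<psi> (\<^bold>\<not> \<chi>) (\<^bold>\<not> \<chi>')"
| left: "replaces \<phi> \<psi> \<chi> \<chi>' \<Longrightarrow> replaces \<phi> \<psi> (Bin c \<chi> \<theta>) (Bin c \<chi>' \<theta>)"
| right: "replaces \<phi> \<psi> \<theta> \<theta>' \<Longrightarrow> replaces \<phi> \<psi> (Bin c \<chi> \<theta>) (Bin c \<chi> \<theta>')"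
| both: "\<lbrakk>replaces \<phi> \<psi> \<chi> \<chi>'; replaces \<phi> \<psi> \<theta> \<theta>'\<rbrakk> \<Longrightarrow> replaces \<phi> \<psi> (Bin c \<chi> \<theta>) (Bin c \<chi>' \<theta>')"

inductive infers :: "'k form set \<Rightarrow> 'k form \<Rightarrow> bool" for S where
  R1: "\<lbrakk>\<phi> \<in> S; \<psi> \<in> S\<rbrakk> \<Longrightarrow> infers S (\<phi> \<^bold>\<and> \<psi>)"
| R2: "(\<phi> \<^bold>\<and> \<psi>) \<in> S \<Longrightarrow> infers S \<phi>"
| R3: "\<lbrakk>(\<phi> \<^bold>\<longleftrightarrow> \<psi>) \<in> S; \<chi> \<in> S; replaces \<phi> \<psi> \<chi> \<chi>'\<rbrakk> \<Longrightarrow> infers S \<chi>'"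

text \<open>Derivations may cite theorems, and theorems are defined through derivations, so the two notions
  are defined by simultaneous induction. A derivation is the list of its lines, in order.
  The rule \<open>R4\<close> has exactly one premise formula.\<close>

inductive irl_theorem :: "'k form \<Rightarrow> bool"
  and derivation :: "'k form set \<Rightarrow> 'k form list \<Rightarrow> bool"
where
  axiom: "irl_axiom y \<Longrightarrow> irl_theorem y"
| derived: "derivation {} (ys @ [y]) \<Longrightarrow> irl_theorem y"
| R4: "derivation {\<phi>} (ys @ [\<psi>]) \<Longrightarrow> irl_theorem (\<phi> \<^bold>\<longrightarrow> \<psi>)"
| start: "finite X \<Longrightarrow> derivation X []"
| cite: "\<lbrakk>derivation X ys; irl_theorem y\<rbrakk> \<Longrightarrow> derivation X (ys @ [y])"
| step: "\<lbrakk>derivation X ys; infers (X \<union> set ys) y\<rbrakk> \<Longrightarrow> derivation X (ys @ [y])"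

definition derives :: "'k form set \<Rightarrow> 'k form \<Rightarrow> bool" (infix "\<turnstile>" 55)
  where "X \<turnstile> y \<longleftrightarrow> (\<exists>ys. derivation X (ys @ [y]))"

lemma irl_theorem_iff_derives: "irl_theorem y \<longleftrightarrow> {} \<turnstile> y"
proof
  assume "irl_theorem y"
  then have "derivation {} ([] @ [y])"
    by (intro irl_theorem_derivation.cite irl_theorem_derivation.start) simp_all
  then show "{} \<turnstile> y"
    unfolding derives_def by blast
qed (auto simp: derives_def intro: irl_theorem_derivation.derived)

lemma conditional_proof: "{\<phi>} \<turnstile> \<psi> \<Longrightarrow> {} \<turnstile> \<phi> \<^bold>\<longrightarrow> \<psi>"
  unfolding irl_theorem_iff_derives[symmetric]
  by (auto simp: derives_def intro: irl_theorem_derivation.R4)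

end

(* The first implication is R2 followed by R4. For the second, provable equivalence is a congruence,
   and the lattice axioms give p & p = p, hence p & bot = bot, hence the absorption law
   p & (p | q) = (p | bot) & (p | q) = p | (bot & q) = p; by the last axiom schema absorption
   is equivalent to p -> p | q. *)

theory Submission
  imports Defs
begin

text \<open>Both theorems may be cited as lines of a derivation without premises, and R3 then
  supplies its third line.\<close>

lemma irl_theorem_R3:
  assumes "irl_theorem (\<phi> \<^bold>\<longleftrightarrow> \<psi>)" "irl_theorem \<chi>" "replaces \<phi> \<psi> \<chi> \<chi>'"
  shows "irl_theorem \<chi>'"
proof -
  have "derivation {} ([] @ [\<phi> \<^bold>\<longleftrightarrow> \<psi>])"
    by (intro irl_theorem_derivation.cite irl_theorem_derivation.start assms) simp
  then have "derivation {} (([] @ [\<phi> \<^bold>\<longleftrightarrow> \<psi>]) @ [\<chi>])"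
    using assms(2) by (rule irl_theorem_derivation.cite)
  then have "derivation {} ((([] @ [\<phi> \<^bold>\<longleftrightarrow> \<psi>]) @ [\<chi>]) @ [\<chi>'])"
    by (rule irl_theorem_derivation.step) (rule infers.R3[OF _ _ assms(3)]; simp)
  then show ?thesis
    by (rule irl_theorem_derivation.derived)
qed

definition prov_eq :: "'k form \<Rightarrow> 'k form \<Rightarrow> bool" (infix "\<approx>" 50)
  where "\<phi> \<approx> \<psi> \<longleftrightarrow> irl_theorem (\<phi> \<^bold>\<longleftrightarrow> \<psi>)"

lemma prov_eq_axiom: "irl_axiom (\<phi> \<^bold>\<longleftrightarrow> \<psi>) \<Longrightarrow> \<phi> \<approx> \<psi>"
  unfolding prov_eq_def by (rule irl_theorem_derivation.axiom)

lemma prov_eq_sym: "\<phi> \<approx> \<psi> \<Longrightarrow> \<psi> \<approx> \<phi>"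
  using prov_eq_axiom[OF iff_refl, of \<phi>] unfolding prov_eq_def
  by (meson irl_theorem_R3 replaces.here replaces.left)

text \<open>The second equivalence rewrites the right side of the first.\<close>

lemma prov_eq_trans [trans]: "\<phi> \<approx> \<psi> \<Longrightarrow> \<psi> \<approx> \<chi> \<Longrightarrow> \<phi> \<approx> \<chi>"
  unfolding prov_eq_def by (meson irl_theorem_R3 replaces.here replaces.right)

lemma prov_eq_replaces: "\<phi> \<approx> \<psi> \<Longrightarrow> replaces \<phi> \<psi> \<chi> \<chi>' \<Longrightarrow> \<chi> \<approx> \<chi>'"
  using prov_eq_axiom[OF iff_refl, of \<chi>] unfolding prov_eq_def
  by (meson irl_theorem_R3 replaces.right)

lemma prov_eq_left: "\<phi> \<approx> \<psi> \<Longrightarrow> Bin c \<phi> \<chi> \<approx> Bin c \<psi> \<chi>"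
  by (blast intro: prov_eq_replaces replaces.here replaces.left)

lemma prov_eq_right: "\<phi> \<approx> \<psi> \<Longrightarrow> Bin c \<chi> \<phi> \<approx> Bin c \<chi> \<psi>"
  by (blast intro: prov_eq_replaces replaces.here replaces.right)

lemma and_idem: "\<phi> \<^bold>\<and> \<phi> \<approx> \<phi>"
proof -
  have "\<phi> \<^bold>\<and> \<phi> \<approx> (\<phi> \<^bold>\<and> \<phi>) \<^bold>\<or> \<^bold>\<bottom>"
    by (rule prov_eq_sym[OF prov_eq_axiom[OF or_bot]])
  also have "\<dots> \<approx> (\<phi> \<^bold>\<and> \<phi>) \<^bold>\<or> (\<phi> \<^bold>\<and> (\<^bold>\<not> \<phi>))"
    by (rule prov_eq_right[OF prov_eq_sym[OF prov_eq_axiom[OF and_neg]]])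
  also have "\<dots> \<approx> \<phi> \<^bold>\<and> (\<phi> \<^bold>\<or> (\<^bold>\<not> \<phi>))"
    by (rule prov_eq_sym[OF prov_eq_axiom[OF and_or_distrib]])
  also have "\<dots> \<approx> \<phi> \<^bold>\<and> \<^bold>\<top>"
    by (rule prov_eq_right[OF prov_eq_axiom[OF or_neg]])
  also have "\<dots> \<approx> \<phi>"
    by (rule prov_eq_axiom[OF and_top])
  finally show ?thesis .
qed

lemma and_bot: "\<phi> \<^bold>\<and> \<^bold>\<bottom> \<approx> \<^bold>\<bottom>"
proof -
  have "\<phi> \<^bold>\<and> \<^bold>\<bottom> \<approx> \<phi> \<^bold>\<and> (\<phi> \<^bold>\<and> (\<^bold>\<not> \<phi>))"
    by (rule prov_eq_right[OF prov_eq_sym[OF prov_eq_axiom[OF and_neg]]])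
  also have "\<dots> \<approx> (\<phi> \<^bold>\<and> \<phi>) \<^bold>\<and> (\<^bold>\<not> \<phi>)"
    by (rule prov_eq_sym[OF prov_eq_axiom[OF and_assoc]])
  also have "\<dots> \<approx> \<phi> \<^bold>\<and> (\<^bold>\<not> \<phi>)"
    by (rule prov_eq_left[OF and_idem])
  also have "\<dots> \<approx> \<^bold>\<bottom>"
    by (rule prov_eq_axiom[OF and_neg])
  finally show ?thesis .
qed

lemma and_or_absorb: "\<phi> \<^bold>\<and> (\<phi> \<^bold>\<or> \<psi>) \<approx> \<phi>"
proof -
  have "\<phi> \<^bold>\<and> (\<phi> \<^bold>\<or> \<psi>) \<approx> (\<phi> \<^bold>\<or> \<^bold>\<bottom>) \<^bold>\<and> (\<phi> \<^bold>\<or> \<psi>)"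
    by (rule prov_eq_left[OF prov_eq_sym[OF prov_eq_axiom[OF or_bot]]])
  also have "\<dots> \<approx> \<phi> \<^bold>\<or> (\<^bold>\<bottom> \<^bold>\<and> \<psi>)"
    by (rule prov_eq_sym[OF prov_eq_axiom[OF or_and_distrib]])
  also have "\<dots> \<approx> \<phi> \<^bold>\<or> (\<psi> \<^bold>\<and> \<^bold>\<bottom>)"
    by (rule prov_eq_right[OF prov_eq_axiom[OF and_comm]])
  also have "\<dots> \<approx> \<phi> \<^bold>\<or> \<^bold>\<bottom>"
    by (rule prov_eq_right[OF and_bot])
  also have "\<dots> \<approx> \<phi>"
    by (rule prov_eq_axiom[OF or_bot])
  finally show ?thesis .
qed

text \<open>Detachment along an equivalence is R3 applied at the root: the reversed schema
  \<open>imp_iff\<close> replaces the whole hypothesis by the implication.\<close>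

lemma imp_if_prov_eq: "\<phi> \<^bold>\<and> \<psi> \<approx> \<phi> \<Longrightarrow> irl_theorem (\<phi> \<^bold>\<longrightarrow> \<psi>)"
  using prov_eq_sym[OF prov_eq_axiom[OF imp_iff]] unfolding prov_eq_def
  by (blast intro: irl_theorem_R3 replaces.here)

lemma and_imp_left: "irl_theorem ((\<phi> \<^bold>\<and> \<psi>) \<^bold>\<longrightarrow> \<phi>)"
proof -
  \<comment> \<open>Premises are usable without being listed as lines, so one line suffices; the
    explicit empty prefix makes it match \<open>ys @ [y]\<close>.\<close>
  have "derivation {\<phi> \<^bold>\<and> \<psi>} ([] @ [\<phi>])"
    by (intro irl_theorem_derivation.step irl_theorem_derivation.start infers.R2[of _ \<psi>]) simp_all
  then show ?thesis
    by (rule irl_theorem_derivation.R4)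
qed

theorem theorem3p4p9:
  fixes \<phi> \<psi> :: "'k::countable form"
  shows "irl_theorem ((\<phi> \<^bold>\<and> \<psi>) \<^bold>\<longrightarrow> \<phi>) \<and> irl_theorem (\<phi> \<^bold>\<longrightarrow> (\<phi> \<^bold>\<or> \<psi>))"
  using and_imp_left imp_if_prov_eq[OF and_or_absorb] by blast

end
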